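(* Let $\alpha,\beta\in\mathbb C$ with $-\alpha,-\beta\notin\mathbb N_0$, let $c,d\in\mathbb C\setminus\{0,1\}$, and let $x,t\in\mathbb C$. Then $${}_1F_1\!\left(\begin{matrix}-x\\ \alpha\end{matrix};\frac{t(1-c)}{c}\right)=\sum_{n=0}^{\infty}\frac{(\beta)_n}{(\alpha)_n\,n!}\left(\frac{d(1-c)}{c(1-d)}\right)^n{}_1F_1\!\left(\begin{matrix}\beta+n\\ \alpha+n\end{matrix};\frac{-td(1-c)}{c(1-d)}\right)M_n(x;\beta,d)\,t^n.$$
   Context: $\mathbb N_0=\{0,1,2,\dots\}$. Pochhammer symbol: $(a)_n=a(a+1)\cdots(a+n-1)$, $(a)_0=1$. ${}_1F_1\!\left(\begin{matrix}a\\ b\end{matrix};z\right)=\sum_{k\ge0}\frac{(a)_k}{(b)_k}\frac{z^k}{k!}$. Meixner polynomials (for $-\beta\notin\mathbb N_0$, $d\ne0$): $M_n(x;\beta,d)={}_2F_1\!\left(\begin{matrix}-n,\,-x\\ \beta\end{matrix};1-\frac1d\right)=\sum_{k=0}^n\frac{(-n)_k(-x)_k}{(\beta)_k\,k!}\left(1-\frac1d\right)^k$. *)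

theory Defs
  imports Complex_Main
begin

text \<open>
  The series defining \<open>hyp1F1 a b z\<close> converges for every \<open>z\<close> whenever \<open>- b \<notin> \<nat>\<close>.
  For other \<open>b\<close> the definition has no mathematical meaning, since division by zero yields zero.
\<close>

definition hyp1F1 :: "complex \<Rightarrow> complex \<Rightarrow> complex \<Rightarrow> complex" where
  "hyp1F1 a b z = (\<Sum>k. pochhammer a k / pochhammer b k * (z ^ k / fact k))"

text \<open>
  The terminating series \<open>\<^sub>2F\<^sub>1(- n, - x; \<beta>; 1 - 1 / d)\<close>; meaningful for
  \<open>- \<beta> \<notin> \<nat>\<close> and \<open>d \<noteq> 0\<close>.
\<close>

definition meixner :: "nat \<Rightarrow> complex \<Rightarrow> complex \<Rightarrow> complex \<Rightarrow> complex" where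
  "meixner n x \<beta> d =
     (\<Sum>k=0..n. pochhammer (- of_nat n) k * pochhammer (- x) k / (pochhammer \<beta> k * fact k)
        * (1 - 1 / d) ^ k)"

end

theory Submission
  imports Defs "HOL-Analysis.Infinite_Sum"
begin

text \<open>
  Put \<open>u = t d (1 - c) / (c (1 - d))\<close> and \<open>w = 1 - 1 / d\<close>, so that \<open>- u w = t (1 - c) / c\<close>
  is the argument on the left-hand side. Two observations turn the identity into a statement
  about binomial sums. Since \<open>(\<beta>)\<^sub>n (\<beta> + n)\<^sub>k = (\<beta>)\<^bsub>n+k\<^esub>\<close>, the quotient \<open>(\<beta>)\<^sub>n / (\<alpha>)\<^sub>n\<close> is
  absorbed into the confluent series, which becomes a series in \<open>(\<beta>)\<^bsub>n+k\<^esub> / (\<alpha>)\<^bsub>n+k\<^esub>\<close>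
  (\<open>pochhammer_ratio_hyp1F1\<close>). And the Meixner polynomial is, as a function of its degree, the
  alternating binomial transform of \<open>q j = (- x)\<^sub>j / (\<beta>)\<^sub>j w\<^sup>j\<close>
  (\<open>meixner_eq_binomial_transform\<close>).

  The right-hand side is therefore a double series over \<open>(n, k)\<close>. Along the diagonal
  \<open>n + k = N\<close> the factor \<open>(\<beta>)\<^sub>N / (\<alpha>)\<^sub>N\<close> is constant, \<open>u\<^sup>n (- u)\<^sup>k / (n! k!)\<close> equals
  \<open>(- u)\<^sup>N / N!\<close> times \<open>(- 1)\<^sup>n\<close> times the binomial coefficient, and the finite sum over the
  diagonal is the same alternating transform applied once more. That transform is an involution
  (\<open>binomial_inversion\<close>), so the diagonal contributes
  \<open>(\<beta>)\<^sub>N / (\<alpha>)\<^sub>N * (- x)\<^sub>N / (\<beta>)\<^sub>N * (- u w)\<^sup>N / N!\<close>; the factors \<open>(\<beta>)\<^sub>N\<close> cancel and what is left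
  is the general term of the left-hand side.

  Summation by diagonals is legitimate because both Pochhammer quotients grow at most
  geometrically (\<open>pochhammer_ratio_geometric_bound\<close>), and the transform preserves such growth,
  so that the factorials dominate and the double series converges absolutely. The rearrangement
  is the same for any two sequences of geometric growth:
  \<open>binomial_transform_series\<close>.
\<close>

section \<open>The alternating binomial transform\<close>

text \<open>
  After exchanging the two sums, the trinomial revision
  \<open>(N choose n) (n choose j) = (N choose j) (N - j choose n - j)\<close> makes the coefficient of
  \<open>q j\<close> a multiple of the expansion of \<open>(1 - 1)\<^bsup>N-j\<^esup>\<close>, so only \<open>j = N\<close> survives.
\<close>

lemma binomial_inversion:
  fixes q :: "nat \<Rightarrow> 'a :: comm_ring_1"
  shows "(\<Sum>n\<le>N. (-1) ^ n * of_nat (N choose n) * (\<Sum>j\<le>n. (-1) ^ j * of_nat (n choose j) * q j)) = q N"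
proof -
  have inner: "(\<Sum>n\<le>N. (-1) ^ n * of_nat ((N choose n) * (n choose j)))
      = (if j = N then (-1) ^ N else 0 :: 'a)" if "j \<le> N" for j
  proof -
    have "(\<Sum>n\<le>N. (-1) ^ n * of_nat ((N choose n) * (n choose j)))
        = (\<Sum>n\<in>{j..N}. (-1) ^ n * (of_nat ((N choose n) * (n choose j)) :: 'a))"
      by (rule sum.mono_neutral_right) (auto simp: not_le binomial_eq_0)
    also have "\<dots> = (\<Sum>n\<in>{j..N}. (-1) ^ n * of_nat ((N choose j) * ((N - j) choose (n - j))))"
      by (intro sum.cong refl) (simp only: atLeastAtMost_iff choose_mult)
    also have "\<dots> = (\<Sum>i\<le>N - j. (-1) ^ (i + j) * of_nat ((N choose j) * ((N - j) choose i)))"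
      by (rule sum.reindex_bij_witness[of _ "\<lambda>i. i + j" "\<lambda>n. n - j"]) (use that in auto)
    also have "\<dots> = (-1) ^ j * of_nat (N choose j) * (\<Sum>i\<le>N - j. (-1) ^ i * of_nat ((N - j) choose i))"
      by (simp add: sum_distrib_left power_add mult_ac)
    also have "\<dots> = (if j = N then (-1) ^ N else 0)"
      using that choose_alternating_sum[of "N - j", where ?'a = 'a] by auto
    finally show ?thesis .
  qed
  have "(\<Sum>n\<le>N. (-1) ^ n * of_nat (N choose n) * (\<Sum>j\<le>n. (-1) ^ j * of_nat (n choose j) * q j))
      = (\<Sum>n\<le>N. (-1) ^ n * of_nat (N choose n) * (\<Sum>j\<le>N. (-1) ^ j * of_nat (n choose j) * q j))"
    by (rule sum.cong[OF refl], rule arg_cong[where f = "(*) _"], rule sum.mono_neutral_left)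
      (auto simp: not_le binomial_eq_0)
  also have "\<dots> = (\<Sum>j\<le>N. \<Sum>n\<le>N. (-1) ^ n * of_nat ((N choose n) * (n choose j)) * ((-1) ^ j * q j))"
    unfolding sum_distrib_left by (subst sum.swap) (simp add: mult_ac)
  also have "\<dots> = (\<Sum>j\<le>N. (if j = N then (-1) ^ N else 0) * ((-1) ^ j * q j))"
    by (intro sum.cong refl) (simp only: flip: sum_distrib_right, simp only: inner atMost_iff)
  also have "\<dots> = (\<Sum>j\<le>N. if j = N then (-1) ^ N * ((-1) ^ j * q j) else 0)"
    by (intro sum.cong) auto
  also have "\<dots> = q N"
    by (simp flip: power_add mult.assoc)
  finally show ?thesis .
qed

lemma norm_binomial_transform_le:
  fixes q :: "nat \<Rightarrow> 'a :: real_normed_field"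
  assumes "\<And>n. norm (q n) \<le> Q ^ n"
  shows "norm (\<Sum>j\<le>n. (-1) ^ j * of_nat (n choose j) * q j) \<le> (1 + Q) ^ n"
proof -
  have "norm (\<Sum>j\<le>n. (-1) ^ j * of_nat (n choose j) * q j) \<le> (\<Sum>j\<le>n. of_nat (n choose j) * Q ^ j)"
    by (intro sum_norm_le) (auto simp: norm_mult norm_power intro!: mult_left_mono assms)
  also have "\<dots> = (1 + Q) ^ n"
    using binomial_ring[of Q 1 n] by (simp add: add.commute)
  finally show ?thesis .
qed

section \<open>Summation by diagonals\<close>

lemma summable_on_exp_product:
  fixes A B :: real
  assumes "A \<ge> 0" "B \<ge> 0"
  shows "(\<lambda>(n, k). (A ^ n / fact n) * (B ^ k / fact k)) summable_on (UNIV \<times> UNIV)"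
proof (rule summable_on_SigmaI)
  have exp_has_sum: "((\<lambda>k. C ^ k / fact k) has_sum exp C) UNIV" if "C \<ge> 0" for C :: real
    using exp_converges[of C] that
    by (intro sums_nonneg_imp_has_sum) (auto simp: field_simps scaleR_conv_of_real)
  show "((\<lambda>k. case (n, k) of (n, k) \<Rightarrow> (A ^ n / fact n) * (B ^ k / fact k))
          has_sum (A ^ n / fact n) * exp B) UNIV" for n
    unfolding prod.case by (intro has_sum_cmult_right exp_has_sum assms)
  show "(\<lambda>n. (A ^ n / fact n) * exp B) summable_on UNIV"
    using has_sum_imp_summable[OF exp_has_sum[OF assms(1)]] by (rule summable_on_cmult_left)
qed (use assms in auto)

lemma summable_norm_exp_series:
  fixes f :: "nat \<Rightarrow> complex"
  assumes "\<And>k. norm (f k) \<le> C * R ^ k"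
  shows "summable (\<lambda>k. norm (f k * (z ^ k / fact k)))"
proof (rule summable_comparison_test_ev)
  show "summable (\<lambda>k. C * ((R * norm z) ^ k / fact k))"
    using summable_exp[of "R * norm z"] by (intro summable_mult) (simp add: field_simps)
  show "\<forall>\<^sub>F k in sequentially. norm (norm (f k * (z ^ k / fact k))) \<le> C * ((R * norm z) ^ k / fact k)"
  proof (intro always_eventually allI)
    fix k
    have "norm (norm (f k * (z ^ k / fact k))) = norm (f k) * (norm z ^ k / fact k)"
      by (simp add: norm_mult norm_divide norm_power)
    also have "\<dots> \<le> (C * R ^ k) * (norm z ^ k / fact k)"
      by (intro mult_right_mono assms) auto
    finally show "norm (norm (f k * (z ^ k / fact k))) \<le> C * ((R * norm z) ^ k / fact k)"
      by (simp add: power_mult_distrib mult_ac)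
  qed
qed

text \<open>
  In generating-function terms: if \<open>p n = 1\<close> for all \<open>n\<close>, the inner series is \<open>exp (- u)\<close> and the
  claim says that the exponential generating functions of \<open>q\<close> and of its transform \<open>T\<close> satisfy
  \<open>exp (- u) * T(u) = q(- u)\<close>. The weights \<open>p\<close> can be inserted because they depend only on the
  diagonal \<open>n + k\<close>.
\<close>

lemma binomial_transform_series:
  fixes p q :: "nat \<Rightarrow> complex" and u :: complex
  assumes p: "\<And>n. norm (p n) \<le> P ^ n" and q: "\<And>n. norm (q n) \<le> Q ^ n"
  defines "T \<equiv> \<lambda>n. \<Sum>j\<le>n. (-1) ^ j * of_nat (n choose j) * q j"
  shows "(\<lambda>n. u ^ n / fact n * (\<Sum>k. p (n + k) * ((-u) ^ k / fact k)) * T n)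
           sums (\<Sum>N. p N * q N * (-u) ^ N / fact N)"
proof -
  \<comment> \<open>A bound that holds for exponent one is nonnegative.\<close>
  have PQ: "P \<ge> 0" "Q \<ge> 0"
    using p[of 1] q[of 1] by (auto intro: order_trans[OF norm_ge_zero])
  define F where "F = (\<lambda>(n, k). u ^ n / fact n * (p (n + k) * ((-u) ^ k / fact k)) * T n)"
  have "F summable_on (UNIV \<times> UNIV)"
  proof (rule abs_summable_summable, rule abs_summable_on_comparison_test')
    \<comment> \<open>The bound \<open>P ^ (n + k)\<close> splits between the two exponential series, and the bound
      \<open>(1 + Q) ^ n\<close> on the transform goes to the first one.\<close>
    let ?A = "norm u * P * (1 + Q)" and ?B = "norm u * P"
    show "(\<lambda>(n, k). (?A ^ n / fact n) * (?B ^ k / fact k)) summable_on (UNIV \<times> UNIV)"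
      using PQ by (intro summable_on_exp_product) auto
    fix x :: "nat \<times> nat"
    obtain n k where x: "x = (n, k)" by force
    have "norm (F x) = norm u ^ n / fact n * (norm (p (n + k)) * (norm u ^ k / fact k)) * norm (T n)"
      by (simp add: F_def x norm_mult norm_divide norm_power)
    also have "\<dots> \<le> norm u ^ n / fact n * (P ^ (n + k) * (norm u ^ k / fact k)) * (1 + Q) ^ n"
      unfolding T_def using PQ
      by (intro mult_mono norm_binomial_transform_le p q mult_nonneg_nonneg) auto
    also have "\<dots> = (?A ^ n / fact n) * (?B ^ k / fact k)"
      by (simp add: power_mult_distrib power_add)
    finally show "norm (F x) \<le> (case x of (n, k) \<Rightarrow> (?A ^ n / fact n) * (?B ^ k / fact k))"
      by (simp add: x)
  qed
  then obtain S where S: "(F has_sum S) (UNIV \<times> UNIV)"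
    by (auto simp: summable_on_def)

  have rows: "((\<lambda>k. F (n, k)) has_sum u ^ n / fact n * (\<Sum>k. p (n + k) * ((-u) ^ k / fact k)) * T n) UNIV" for n
  proof -
    let ?g = "\<lambda>k. p (n + k) * ((-u) ^ k / fact k)"
    have "norm (p (n + k)) \<le> P ^ n * P ^ k" for k
      using p[of "n + k"] by (simp add: power_add)
    hence "summable (\<lambda>k. norm (?g k))"
      by (rule summable_norm_exp_series)
    hence "(?g has_sum suminf ?g) UNIV"
      by (intro norm_summable_imp_has_sum summable_sums) (auto intro: summable_norm_cancel)
    thus ?thesis
      unfolding F_def prod.case by (intro has_sum_cmult_left has_sum_cmult_right)
  qed
  have lhs: "(\<lambda>n. u ^ n / fact n * (\<Sum>k. p (n + k) * ((-u) ^ k / fact k)) * T n) sums S"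
    by (rule has_sum_imp_sums, rule has_sum_Sigma'[OF S], rule rows)

  have diagonal: "(\<Sum>n\<le>N. F (n, N - n)) = p N * q N * (-u) ^ N / fact N" for N
  proof -
    have "F (n, N - n) = p N * (-u) ^ N / fact N * ((-1) ^ n * of_nat (N choose n) * T n)" if "n \<le> N" for n
    proof -
      have "u ^ n * (-u) ^ (N - n) = (-1) ^ n * (-u) ^ N"
        using that power_add[of "-u" n "N - n"] by (simp add: power_minus[of u n])
      moreover have "of_nat (N choose n) = fact N / (fact n * fact (N - n) :: complex)"
        using that by (rule binomial_fact)
      ultimately show ?thesis
        using that by (simp add: F_def field_simps)
    qed
    hence "(\<Sum>n\<le>N. F (n, N - n)) = p N * (-u) ^ N / fact N * (\<Sum>n\<le>N. (-1) ^ n * of_nat (N choose n) * T n)"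
      by (simp add: sum_distrib_left)
    also have "(\<Sum>n\<le>N. (-1) ^ n * of_nat (N choose n) * T n) = q N"
      unfolding T_def by (rule binomial_inversion)
    finally show ?thesis by simp
  qed
  have "((\<lambda>(N, n). F (n, N - n)) has_sum S) (SIGMA N:UNIV. {..N})"
    using S by (subst has_sum_reindex_bij_witness[where T = "UNIV \<times> UNIV" and h = F and s' = S
      and j = "\<lambda>(N, n). (n, N - n)" and i = "\<lambda>(n, k). (n + k, n)"]) auto
  hence "((\<lambda>N. \<Sum>n\<le>N. F (n, N - n)) has_sum S) UNIV"
    by (rule has_sum_Sigma') (simp add: has_sum_finite)
  hence "(\<lambda>N. p N * q N * (-u) ^ N / fact N) sums S"
    unfolding diagonal by (rule has_sum_imp_sums)
  with lhs show ?thesis by (simp add: sums_iff)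
qed

section \<open>Series in Pochhammer quotients\<close>

text \<open>
  Consecutive quotients differ by the factor \<open>(a + n) / (b + n)\<close>, which tends to \<open>1\<close> and hence is
  bounded; any bound for these factors serves as \<open>R\<close>.
\<close>

lemma pochhammer_ratio_geometric_bound:
  fixes a b :: complex
  assumes "- b \<notin> \<nat>"
  obtains R where "\<And>n. norm (pochhammer a n / pochhammer b n) \<le> R ^ n"
proof -
  have "filterlim (\<lambda>n. b + of_nat n) at_infinity sequentially"
    by (intro tendsto_add_filterlim_at_infinity[OF tendsto_const] tendsto_of_nat)
  hence "(\<lambda>n. 1 + (a - b) / (b + of_nat n)) \<longlonglongrightarrow> 1 + 0"
    by (intro tendsto_add tendsto_const tendsto_divide_0[OF tendsto_const])
  moreover have "b + of_nat n \<noteq> 0" for n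
    using assms by (metis add.inverse_inverse add_eq_0_iff of_nat_in_Nats)
  hence "(\<lambda>n. 1 + (a - b) / (b + of_nat n)) = (\<lambda>n. (a + of_nat n) / (b + of_nat n))"
    by (auto simp: fun_eq_iff field_simps)
  ultimately have "Bseq (\<lambda>n. (a + of_nat n) / (b + of_nat n))"
    by (metis convergentI convergent_imp_Bseq)
  then obtain R where R: "R > 0" "\<And>n. norm ((a + of_nat n) / (b + of_nat n)) \<le> R"
    by (auto simp: Bseq_def)
  have "norm (pochhammer a n / pochhammer b n) \<le> R ^ n" for n
  proof (induction n)
    case (Suc n)
    have "norm (pochhammer a (Suc n) / pochhammer b (Suc n))
        = norm (pochhammer a n / pochhammer b n) * norm ((a + of_nat n) / (b + of_nat n))"
      by (simp add: pochhammer_Suc norm_mult norm_divide)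
    also have "\<dots> \<le> R ^ n * R"
      using R by (intro mult_mono Suc) auto
    finally show ?case by (simp add: mult.commute)
  qed auto
  thus ?thesis by (rule that)
qed

lemma meixner_eq_binomial_transform:
  "meixner n x \<beta> d = (\<Sum>j\<le>n. (-1) ^ j * of_nat (n choose j)
     * (pochhammer (- x) j / pochhammer \<beta> j * (1 - 1 / d) ^ j))"
proof -
  have "pochhammer (- of_nat n) j = ((-1) ^ j * of_nat (n choose j) * fact j :: complex)" for j
    by (simp add: binomial_gbinomial gbinomial_pochhammer flip: power_add mult.assoc)
  thus ?thesis
    unfolding meixner_def atLeast0AtMost by (intro sum.cong) (simp_all add: field_simps)
qed

text \<open>
  For \<open>- b \<in> \<nat>\<close> some denominators vanish. Otherwise the confluent series converges, so that the
  prefactor may be multiplied into it.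
\<close>

lemma pochhammer_ratio_hyp1F1:
  fixes a b z :: complex
  assumes "- b \<notin> \<nat>"
  shows "pochhammer a n / pochhammer b n * hyp1F1 (a + of_nat n) (b + of_nat n) z
     = (\<Sum>k. pochhammer a (n + k) / pochhammer b (n + k) * (z ^ k / fact k))"
proof -
  let ?f = "\<lambda>k. pochhammer (a + of_nat n) k / pochhammer (b + of_nat n) k"
  have "- (b + of_nat n) \<notin> \<nat>"
  proof
    assume "- (b + of_nat n) \<in> \<nat>"
    hence "- (b + of_nat n) + of_nat n \<in> \<nat>"
      by (rule Nats_add) simp
    with assms show False by simp
  qed
  then obtain R where "\<And>k. norm (?f k) \<le> R ^ k"
    using pochhammer_ratio_geometric_bound[of "b + of_nat n" "a + of_nat n"] by metis
  hence "summable (\<lambda>k. norm (?f k * (z ^ k / fact k)))"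
    by (intro summable_norm_exp_series[where C = 1]) auto
  hence "summable (\<lambda>k. ?f k * (z ^ k / fact k))"
    by (rule summable_norm_cancel)
  thus ?thesis
    unfolding hyp1F1_def by (subst suminf_mult[symmetric]) (simp_all add: pochhammer_product' mult_ac)
qed

section \<open>The expansion in Meixner polynomials\<close>

theorem theorem8:
  fixes \<alpha> \<beta> c d x t :: complex
  assumes "- \<alpha> \<notin> \<nat>" and "- \<beta> \<notin> \<nat>"
    and "c \<notin> {0, 1}" and "d \<notin> {0, 1}"
  shows "(\<lambda>n. pochhammer \<beta> n / (pochhammer \<alpha> n * fact n)
              * (d * (1 - c) / (c * (1 - d))) ^ n
              * hyp1F1 (\<beta> + of_nat n) (\<alpha> + of_nat n) (- t * d * (1 - c) / (c * (1 - d)))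
              * meixner n x \<beta> d * t ^ n)
         sums hyp1F1 (- x) \<alpha> (t * (1 - c) / c)"
proof -
  have nz: "pochhammer \<beta> n \<noteq> 0" for n
    using assms(2) by (auto simp: pochhammer_eq_0_iff)
  define u where "u = t * (d * (1 - c) / (c * (1 - d)))"
  define w where "w = 1 - 1 / d"
  define p where "p = (\<lambda>n. pochhammer \<beta> n / pochhammer \<alpha> n)"
  define q where "q = (\<lambda>n. pochhammer (- x) n / pochhammer \<beta> n * w ^ n)"
  obtain P where P: "\<And>n. norm (p n) \<le> P ^ n"
    using pochhammer_ratio_geometric_bound[OF assms(1), of \<beta>] unfolding p_def by metis
  obtain R where R: "\<And>n. norm (pochhammer (- x) n / pochhammer \<beta> n) \<le> R ^ n"
    using pochhammer_ratio_geometric_bound[OF assms(2), of "- x"] by metis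
  have Q: "norm (q n) \<le> (R * norm w) ^ n" for n
    unfolding q_def norm_mult norm_power power_mult_distrib by (intro mult_right_mono R) simp

  have "u ^ n / fact n * (\<Sum>k. p (n + k) * ((-u) ^ k / fact k))
          * (\<Sum>j\<le>n. (-1) ^ j * of_nat (n choose j) * q j)
      = pochhammer \<beta> n / (pochhammer \<alpha> n * fact n) * (d * (1 - c) / (c * (1 - d))) ^ n
          * hyp1F1 (\<beta> + of_nat n) (\<alpha> + of_nat n) (- t * d * (1 - c) / (c * (1 - d)))
          * meixner n x \<beta> d * t ^ n" for n
  proof -
    have arg: "- t * d * (1 - c) / (c * (1 - d)) = - u"
      by (simp add: u_def)
    have "(\<Sum>k. p (n + k) * ((-u) ^ k / fact k))
        = pochhammer \<beta> n / pochhammer \<alpha> n * hyp1F1 (\<beta> + of_nat n) (\<alpha> + of_nat n) (-u)"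
      unfolding p_def using assms(1) by (rule pochhammer_ratio_hyp1F1[symmetric])
    moreover have "(\<Sum>j\<le>n. (-1) ^ j * of_nat (n choose j) * q j) = meixner n x \<beta> d"
      by (simp add: meixner_eq_binomial_transform q_def w_def)
    moreover have "u ^ n = t ^ n * (d * (1 - c) / (c * (1 - d))) ^ n"
      unfolding u_def by (rule power_mult_distrib)
    ultimately show ?thesis
      unfolding arg by (simp only: mult_ac times_divide_eq_right times_divide_eq_left divide_divide_eq_left)
  qed
  moreover have "p N * q N * (-u) ^ N / fact N
      = pochhammer (- x) N / pochhammer \<alpha> N * ((t * (1 - c) / c) ^ N / fact N)" for N
  proof -
    have "w * (-u) = t * (1 - c) / c"
      using assms(3,4) by (simp add: u_def w_def divide_simps) (simp add: algebra_simps)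
    hence "w ^ N * (-u) ^ N = (t * (1 - c) / c) ^ N"
      by (metis power_mult_distrib)
    thus ?thesis
      using nz[of N] by (simp add: p_def q_def)
  qed
  ultimately show ?thesis
    using binomial_transform_series[OF P Q, of u] by (simp add: hyp1F1_def)
qed

end
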